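(* Let $P$ and $Q$ be finite posets. Then the following hold: (a) For every $\mathfrak{p} \in \operatorname{Min}(L(P,Q))$, there exists a multivalued map $\psi \in \operatorname{MHom}(Q,P)$ such that $\mathfrak{p} = \mathfrak{p}_\psi$. (b) Let $\psi \in \operatorname{MHom}(Q,P)$. Then $L(P,Q) \subseteq \mathfrak{p}_\psi$ if and only if for every $\phi \in \operatorname{Hom}(P,Q)$, there exists an element $p \in P$ such that $p \in \psi(\phi(p))$.
   Context: All posets are finite and nonempty; $\mathbb{K}$ is an arbitrary field. $\operatorname{Hom}(P,Q)$ is the set of order-preserving maps $P\to Q$. $S_{P,Q}=\mathbb{K}[x_{p,q} : p\in P, q\in Q]$, $u_\phi=\prod_{p\in P}x_{p,\phi(p)}$, and $L(P,Q)=(u_\phi : \phi\in \operatorname{Hom}(P,Q))\subseteq S_{P,Q}$. $\operatorname{Min}(I)$ is the set of minimal primes of $I$. For $\psi\subseteq Q\times P$ and $q\in Q$ put $\psi(q)=\{p\in P : (q,p)\in\psi\}$ and $\mathfrak{p}_\psi=(x_{p,q} : (q,p)\in\psi)\subseteq S_{P,Q}$. $\operatorname{MHom}(Q,P)$ (order-preserving multivalued maps from $Q$ to $P$) is the collection of sets $\psi\subseteq Q\times P$ such that (i) $\psi(q)\ne\emptyset$ for all $q\in Q$, and (ii) for all $q,q'\in Q$ with $q<q'$ there exist $p\in\psi(q)$ and $p'\in\psi(q')$ with $p\le p'$. *)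

theory Defs
  imports "HOL-Library.Poly_Mapping" "HOL-Algebra.Algebraic_Closure_Type"
begin

text \<open>
  Finite nonempty posets \<open>P\<close>, \<open>Q\<close> are types \<open>'p\<close>, \<open>'q\<close> of sort \<open>{finite, order}\<close>, and
  \<open>\<K>\<close> is a type \<open>'k\<close> of class \<open>field\<close>. The ring \<open>S\<^sub>P\<^sub>,\<^sub>Q\<close> is the monoid algebra over \<open>'k\<close> of the
  exponent vectors \<open>('p \<times> 'q) \<Rightarrow>\<^sub>0 nat\<close>; its multiplication is the convolution product of
  \<^theory>\<open>HOL-Library.Poly_Mapping\<close>.
\<close>

type_synonym ('p, 'q, 'k) hpoly = "(('p \<times> 'q) \<Rightarrow>\<^sub>0 nat) \<Rightarrow>\<^sub>0 'k"

abbreviation hring :: "('p, 'q, 'k::field) hpoly ring"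
  where "hring \<equiv> ring_of_type_algebra"

definition hvar :: "'p \<Rightarrow> 'q \<Rightarrow> ('p, 'q, 'k::field) hpoly"
  where "hvar p q = Poly_Mapping.single (Poly_Mapping.single (p, q) 1) 1"

definition Hom :: "('p::{finite,order} \<Rightarrow> 'q::{finite,order}) set"
  where "Hom = {\<phi>. mono \<phi>}"

definition hmonom :: "('p::finite \<Rightarrow> 'q) \<Rightarrow> ('p, 'q, 'k::field) hpoly"
  where "hmonom \<phi> = (\<Prod>p\<in>UNIV. hvar p (\<phi> p))"

definition hom_ideal :: "('p::{finite,order}, 'q::{finite,order}, 'k::field) hpoly set"
  where "hom_ideal = Idl\<^bsub>hring\<^esub> (hmonom ` Hom)"

definition min_primes :: "('a, 'm) ring_scheme \<Rightarrow> 'a set \<Rightarrow> 'a set set"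
  where "min_primes R I =
    {J. primeideal J R \<and> I \<subseteq> J \<and> (\<forall>J'. primeideal J' R \<and> I \<subseteq> J' \<and> J' \<subseteq> J \<longrightarrow> J' = J)}"

text \<open>For \<open>\<psi> \<subseteq> Q \<times> P\<close>, the set \<open>\<psi>(q) = {p. (q, p) \<in> \<psi>}\<close> is the relational image \<open>\<psi> `` {q}\<close>.\<close>

definition MHom :: "('q::{finite,order} \<times> 'p::{finite,order}) set set"
  where "MHom = {\<psi>. (\<forall>q. \<psi> `` {q} \<noteq> {}) \<and>
    (\<forall>q q'. q < q' \<longrightarrow> (\<exists>p \<in> \<psi> `` {q}. \<exists>p' \<in> \<psi> `` {q'}. p \<le> p'))}"

definition var_ideal :: "('q \<times> 'p) set \<Rightarrow> ('p, 'q, 'k::field) hpoly set"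
  where "var_ideal \<psi> = Idl\<^bsub>hring\<^esub> {hvar p q | p q. (q, p) \<in> \<psi>}"

end

theory Submission
  imports Defs
begin

text \<open>
  A prime ideal containing \<open>L(P,Q)\<close> contains a variable of every \<open>u\<^sub>\<phi>\<close>, so it contains
  \<open>\<pp>\<^sub>\<psi> \<supseteq> L(P,Q)\<close>, where \<open>\<psi>\<close> collects all its variables; ideals generated by variables are prime,
  whence equality for a minimal prime. That \<open>\<psi>\<close> is a multivalued order-preserving map is seen by
  testing it against the constant maps and, for \<open>q < q'\<close>, against the map sending the up-set
  generated by \<open>\<psi>(q)\<close> to \<open>q'\<close> and its complement to \<open>q\<close>.
\<close>

section \<open>Coefficients of products and extremal exponents\<close>

text \<open>Only the summand \<open>l = m\<close> of the convolution survives: any other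
  \<open>l\<close> outside \<open>keys f\<close> has coefficient 0, and any other \<open>l\<close>
  in \<open>keys f\<close> has no partner in \<open>keys g\<close>. For \<open>l = m\<close>,
  cancellation forces the partner to be \<open>n\<close>.\<close>

lemma lookup_mult_unique:
  fixes f g :: "'a::cancel_comm_monoid_add \<Rightarrow>\<^sub>0 'b::semiring_0"
  assumes uniq: "\<And>l q. l \<in> Poly_Mapping.keys f \<Longrightarrow> q \<in> Poly_Mapping.keys g \<Longrightarrow> l + q = m + n \<Longrightarrow> l = m"
  shows "Poly_Mapping.lookup (f * g) (m + n) = Poly_Mapping.lookup f m * Poly_Mapping.lookup g n"
proof -
  have "Poly_Mapping.lookup f l * (\<Sum>q. Poly_Mapping.lookup g q when m + n = l + q) =
      (Poly_Mapping.lookup f m * Poly_Mapping.lookup g n when l = m)" for l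
  proof (cases "l = m \<or> l \<notin> Poly_Mapping.keys f")
    case True
    then show ?thesis
      by (auto simp: in_keys_iff when_def)
  next
    case False
    then have "(Poly_Mapping.lookup g q when m + n = l + q) = 0" for q
      using uniq[of l q] by (metis in_keys_iff when_def)
    then show ?thesis
      using False by simp
  qed
  then show ?thesis
    by (simp add: lookup_mult)
qed

text \<open>
  The index type carries no linear order, so exponent vectors are compared after reindexing
  them by natural numbers.
\<close>

lemma exponents_unique_sum:
  fixes A B :: "('a::finite \<Rightarrow>\<^sub>0 nat) set"
  assumes "finite A" "A \<noteq> {}" "finite B" "B \<noteq> {}"
  obtains m n where "m \<in> A" "n \<in> B"
    "\<And>l q. l \<in> A \<Longrightarrow> q \<in> B \<Longrightarrow> l + q = m + n \<Longrightarrow> l = m"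
proof -
  obtain e :: "'a \<Rightarrow> nat" where "inj e"
    using finite_imp_inj_to_nat_seg[OF finite_UNIV] by blast
  \<comment> \<open>\<open>w\<close> is an additive embedding into a monoid with a
    translation-invariant linear order; \<open>m\<close> and \<open>n\<close> below are the points
    of \<open>A\<close> and \<open>B\<close> where \<open>w\<close> is largest.\<close>
  define w :: "('a \<Rightarrow>\<^sub>0 nat) \<Rightarrow> (nat \<Rightarrow>\<^sub>0 nat)"
    where "w m = (\<Sum>i\<in>UNIV. Poly_Mapping.single (e i) (Poly_Mapping.lookup m i))" for m
  have w_add: "w (m + n) = w m + w n" for m n
    by (simp add: w_def lookup_add single_add sum.distrib)
  have "Poly_Mapping.lookup (w m) (e i) = Poly_Mapping.lookup m i" for m i
    using \<open>inj e\<close> by (simp add: w_def lookup_sum lookup_single inj_eq when_def)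
  then have "inj w"
    by (metis injI poly_mapping_eqI)
  obtain m where m: "m \<in> A" "\<And>l. l \<in> A \<Longrightarrow> w l \<le> w m"
    using obtains_MAX[of A w] \<open>finite A\<close> \<open>A \<noteq> {}\<close> by (metis Max_ge finite_imageI imageI)
  obtain n where n: "n \<in> B" "\<And>q. q \<in> B \<Longrightarrow> w q \<le> w n"
    using obtains_MAX[of B w] \<open>finite B\<close> \<open>B \<noteq> {}\<close> by (metis Max_ge finite_imageI imageI)
  show thesis
  proof (rule that[OF \<open>m \<in> A\<close> \<open>n \<in> B\<close>])
    fix l q assume *: "l \<in> A" "q \<in> B" "l + q = m + n"
    have "w l + w q = w m + w n"
      using *(3) w_add by metis
    \<comment> \<open>If \<open>w l < w m\<close>, then \<open>w q \<le> w n\<close> would make the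
      left sum strictly smaller.\<close>
    then have "w l = w m"
      using m(2)[OF *(1)] n(2)[OF *(2)] add_less_le_mono[of "w l" "w m" "w q" "w n"] by fastforce
    then show "l = m"
      using \<open>inj w\<close> by (simp add: inj_eq)
  qed
qed

section \<open>Ideals of a ring given by a type\<close>

text \<open>Closure under negation follows from multiplying by \<open>-1\<close>; what remains is to
  identify the abstract inverse of the ring structure with this element, by uniqueness of
  inverses.\<close>

lemma ideal_ring_of_type_algebraI:
  fixes I :: "'a::comm_ring_1 set"
  assumes "0 \<in> I" and "\<And>a b. a \<in> I \<Longrightarrow> b \<in> I \<Longrightarrow> a + b \<in> I"
    and mult: "\<And>a x. a \<in> I \<Longrightarrow> x * a \<in> I"
  shows "ideal I ring_of_type_algebra"
proof -
  interpret cring "ring_of_type_algebra :: 'a ring" ..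
  have inv: "\<exists>b\<in>I. a + b = 0" if "a \<in> I" for a
    using mult[OF that, of "-1"] by (intro bexI[of _ "- a"]) auto
  have "\<ominus>\<^bsub>ring_of_type_algebra\<^esub> a \<in> I" if "a \<in> I" for a :: 'a
  proof -
    obtain b where "b \<in> I" "a + b = 0"
      using inv \<open>a \<in> I\<close> by blast
    then have "\<ominus>\<^bsub>ring_of_type_algebra\<^esub> a = b"
      by (intro minus_equality) (auto simp: ring_of_type_algebra_def add.commute)
    then show ?thesis
      using \<open>b \<in> I\<close> by simp
  qed
  then show ?thesis
    using assms ring_axioms
    by (intro idealI add.subgroupI) (auto simp: ring_of_type_algebra_def a_inv_def mult.commute)
qed

context
  fixes I :: "'a::comm_ring_1 set"
  assumes I: "ideal I ring_of_type_algebra"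
begin

interpretation ideal I "ring_of_type_algebra :: 'a ring"
  by (rule I)

lemma ideal_zero: "0 \<in> I"
  using additive_subgroup.zero_closed[OF is_additive_subgroup] by (simp add: ring_of_type_algebra_def)

lemma ideal_add: "a \<in> I \<Longrightarrow> b \<in> I \<Longrightarrow> a + b \<in> I"
  using additive_subgroup.a_closed[OF is_additive_subgroup] by (simp add: ring_of_type_algebra_def)

lemma ideal_mult: "a \<in> I \<Longrightarrow> x * a \<in> I"
  using I_l_closed by (simp add: ring_of_type_algebra_def)

lemma ideal_sum: "(\<And>i. i \<in> A \<Longrightarrow> f i \<in> I) \<Longrightarrow> sum f A \<in> I"
  by (induction A rule: infinite_finite_induct) (auto simp: ideal_zero ideal_add)

end

lemma primeideal_prod:
  fixes J :: "'a::comm_ring_1 set"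
  assumes "primeideal J ring_of_type_algebra" "finite A" "prod f A \<in> J"
  shows "\<exists>i\<in>A. f i \<in> J"
proof -
  interpret primeideal J "ring_of_type_algebra :: 'a ring" by fact
  \<comment> \<open>A prime ideal is proper; this rules out the empty product in the
    induction.\<close>
  have "1 \<notin> J"
    using I_notcarr one_imp_carrier by (auto simp: ring_of_type_algebra_def)
  have prime: "a \<in> J \<or> b \<in> J" if "a * b \<in> J" for a b
    using I_prime[of a b] that by (simp add: ring_of_type_algebra_def)
  from assms(2,3) show ?thesis
    by (induction A rule: finite_induct) (use \<open>1 \<notin> J\<close> prime in auto)
qed

lemma hring_Idl:
  fixes A :: "('p, 'q, 'k::field) hpoly set"
  shows "ideal (Idl\<^bsub>hring\<^esub> A) hring" "A \<subseteq> Idl\<^bsub>hring\<^esub> A"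
    "ideal I hring \<Longrightarrow> Idl\<^bsub>hring\<^esub> A \<subseteq> I \<longleftrightarrow> A \<subseteq> I"
proof -
  interpret ring "hring :: ('p, 'q, 'k) hpoly ring" ..
  have "A \<subseteq> carrier hring"
    by (simp add: ring_of_type_algebra_def)
  then show "ideal (Idl\<^bsub>hring\<^esub> A) hring" and *: "A \<subseteq> Idl\<^bsub>hring\<^esub> A"
    by (auto intro: genideal_ideal dest: genideal_self)
  show "Idl\<^bsub>hring\<^esub> A \<subseteq> I \<longleftrightarrow> A \<subseteq> I" if "ideal I hring"
    using genideal_minimal[OF that] * by blast
qed

section \<open>Ideals generated by variables\<close>

text \<open>The polynomials whose monomials are all divisible by a variable of \<open>\<psi>\<close>
  form an ideal containing the generators. Conversely, each term of such a polynomial is a multiple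
  of a generator, and the polynomial is the sum of its terms.\<close>

lemma var_ideal_iff:
  fixes f :: "('p, 'q, 'k::field) hpoly"
  shows "f \<in> var_ideal \<psi> \<longleftrightarrow>
    (\<forall>m \<in> Poly_Mapping.keys f. \<exists>(q, p) \<in> \<psi>. Poly_Mapping.lookup m (p, q) \<noteq> 0)"
    (is "_ \<longleftrightarrow> (\<forall>m \<in> _. ?D m)")
proof
  let ?I = "{f :: ('p, 'q, 'k) hpoly. \<forall>m \<in> Poly_Mapping.keys f. ?D m}"
  have "ideal ?I hring"
  proof (rule ideal_ring_of_type_algebraI)
    fix a b assume "a \<in> ?I" "b \<in> ?I"
    then show "a + b \<in> ?I"
      using Poly_Mapping.keys_add[of a b] by blast
  next
    fix a x :: "('p, 'q, 'k) hpoly" assume a: "a \<in> ?I"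
    have "?D m" if m: "m \<in> Poly_Mapping.keys (x * a)" for m
    proof -
      obtain k l where "m = k + l" "l \<in> Poly_Mapping.keys a"
        using m keys_mult[of x a] by blast
      moreover from this have "?D l"
        using a by blast
      ultimately show ?thesis
        by (auto simp: lookup_add)
    qed
    then show "x * a \<in> ?I" by blast
  qed simp
  moreover have "{hvar p q | p q. (q, p) \<in> \<psi>} \<subseteq> ?I"
  proof safe
    fix p q m assume "(q, p) \<in> \<psi>" "m \<in> Poly_Mapping.keys (hvar p q :: ('p, 'q, 'k) hpoly)"
    then show "?D m"
      by (intro bexI[of _ "(q, p)"]) (simp_all add: hvar_def)
  qed
  ultimately have "var_ideal \<psi> \<subseteq> ?I"
    by (simp add: var_ideal_def hring_Idl)
  then show "\<forall>m \<in> Poly_Mapping.keys f. ?D m" if "f \<in> var_ideal \<psi>"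
    using that by blast
next
  assume f: "\<forall>m \<in> Poly_Mapping.keys f. ?D m"
  have is_ideal: "ideal (var_ideal \<psi> :: ('p, 'q, 'k) hpoly set) hring"
    by (simp add: var_ideal_def hring_Idl)
  have "Poly_Mapping.single m (Poly_Mapping.lookup f m) \<in> var_ideal \<psi>"
    if m: "m \<in> Poly_Mapping.keys f" for m
  proof -
    obtain p q where pq: "(q, p) \<in> \<psi>" "Poly_Mapping.lookup m (p, q) \<noteq> 0"
      using f m by blast
    \<comment> \<open>Subtraction of exponents is truncated, so adding the variable back restores
      \<open>m\<close> only because its exponent in \<open>m\<close> is nonzero.\<close>
    have "(m - Poly_Mapping.single (p, q) 1) + Poly_Mapping.single (p, q) 1 = m"
      using pq(2) by (intro poly_mapping_eqI) (auto simp: lookup_add lookup_minus lookup_single when_def)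
    then have "Poly_Mapping.single m (Poly_Mapping.lookup f m) =
        Poly_Mapping.single (m - Poly_Mapping.single (p, q) 1) (Poly_Mapping.lookup f m) * hvar p q"
      by (simp add: hvar_def mult_single)
    moreover have "hvar p q \<in> (var_ideal \<psi> :: ('p, 'q, 'k) hpoly set)"
      unfolding var_ideal_def by (rule subsetD[OF hring_Idl(2)]) (use pq(1) in blast)
    ultimately show ?thesis
      by (simp add: ideal_mult[OF is_ideal])
  qed
  then have "(\<Sum>m \<in> Poly_Mapping.keys f. Poly_Mapping.single m (Poly_Mapping.lookup f m)) \<in> var_ideal \<psi>"
    by (rule ideal_sum[OF is_ideal])
  moreover have "(\<Sum>m \<in> Poly_Mapping.keys f. Poly_Mapping.single m (Poly_Mapping.lookup f m)) = f"
    by (rule poly_mapping_eqI) (auto simp: lookup_sum lookup_single when_def in_keys_iff)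
  ultimately show "f \<in> var_ideal \<psi>"
    by simp
qed

lemma hvar_in_var_ideal_iff:
  "(hvar p q :: ('p, 'q, 'k::field) hpoly) \<in> var_ideal \<psi> \<longleftrightarrow> (q, p) \<in> \<psi>"
  by (auto simp: var_ideal_iff hvar_def lookup_single when_def)

text \<open>If \<open>f\<close> and \<open>g\<close> lie outside the ideal, both have monomials free
  of the variables of \<open>\<psi>\<close>. Among these, exponents \<open>m\<close> and
  \<open>n\<close> with a unique sum give the free exponent \<open>m + n\<close> a nonzero
  coefficient in \<open>f * g\<close>, since a field has no zero divisors.\<close>

lemma primeideal_var_ideal:
  "primeideal (var_ideal \<psi> :: ('p::finite, 'q::finite, 'k::field) hpoly set) hring"
proof (rule primeidealI)
  let ?I = "var_ideal \<psi> :: ('p, 'q, 'k) hpoly set"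
  let ?D = "\<lambda>m. \<exists>(q, p) \<in> \<psi>. Poly_Mapping.lookup m (p, q) \<noteq> (0::nat)"
  show "ideal ?I hring"
    by (simp add: var_ideal_def hring_Idl)
  show "cring (hring :: ('p, 'q, 'k) hpoly ring)" ..
  have "1 \<notin> ?I"
    by (simp add: var_ideal_iff)
  then show "carrier hring \<noteq> ?I"
    by (auto simp: ring_of_type_algebra_def)
  fix f g :: "('p, 'q, 'k) hpoly"
  assume fg: "f \<otimes>\<^bsub>hring\<^esub> g \<in> ?I"
  show "f \<in> ?I \<or> g \<in> ?I"
  proof (rule ccontr)
    assume "\<not> (f \<in> ?I \<or> g \<in> ?I)"
    then have ne: "{m \<in> Poly_Mapping.keys f. \<not> ?D m} \<noteq> {}" "{m \<in> Poly_Mapping.keys g. \<not> ?D m} \<noteq> {}"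
      unfolding var_ideal_iff by blast+
    obtain m n where mn: "m \<in> {m \<in> Poly_Mapping.keys f. \<not> ?D m}" "n \<in> {m \<in> Poly_Mapping.keys g. \<not> ?D m}"
      and uniq: "\<And>l q. l \<in> {m \<in> Poly_Mapping.keys f. \<not> ?D m} \<Longrightarrow>
          q \<in> {m \<in> Poly_Mapping.keys g. \<not> ?D m} \<Longrightarrow> l + q = m + n \<Longrightarrow> l = m"
      by (rule exponents_unique_sum[OF _ ne(1) _ ne(2)]) (simp, simp, blast)
    have D_add: "?D (k + l) \<longleftrightarrow> ?D k \<or> ?D l" for k l
      by (auto simp: lookup_add)
    have not_D: "\<not> ?D (m + n)"
      using mn D_add[of m n] by blast
    have "Poly_Mapping.lookup (f * g) (m + n) = Poly_Mapping.lookup f m * Poly_Mapping.lookup g n"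
    \<comment> \<open>Exponents are natural numbers and cannot cancel, so both summands of the free
      exponent \<open>m + n\<close> are free; uniqueness thus extends to all of
      \<open>keys f\<close> and \<open>keys g\<close>.\<close>
    proof (rule lookup_mult_unique)
      fix l q assume "l \<in> Poly_Mapping.keys f" "q \<in> Poly_Mapping.keys g" and eq: "l + q = m + n"
      moreover have "\<not> ?D l" "\<not> ?D q"
        using not_D D_add[of l q] unfolding eq by blast+
      ultimately show "l = m"
        using uniq by blast
    qed
    then have "m + n \<in> Poly_Mapping.keys (f * g)"
      using mn by (simp add: in_keys_iff)
    moreover have "f * g \<in> ?I"
      using fg by (simp add: ring_of_type_algebra_def)
    ultimately show False
      using not_D unfolding var_ideal_iff by blast
  qed
qed

section \<open>Primes over L(P,Q) and multivalued maps\<close>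

text \<open>It suffices to test the generators, and a prime ideal contains a product exactly when it
  contains a factor. Containment therefore depends only on which variables lie in
  \<open>J\<close>.\<close>

lemma hom_ideal_subset_primeideal_iff:
  fixes J :: "('p::{finite,order}, 'q::{finite,order}, 'k::field) hpoly set"
  assumes J: "primeideal J hring"
  shows "hom_ideal \<subseteq> J \<longleftrightarrow> (\<forall>\<phi> \<in> Hom. \<exists>p. hvar p (\<phi> p) \<in> J)"
proof -
  have is_ideal: "ideal J hring"
    using J by (simp add: primeideal_def)
  have "hmonom \<phi> \<in> J \<longleftrightarrow> (\<exists>p. hvar p (\<phi> p) \<in> J)" for \<phi> :: "'p \<Rightarrow> 'q"
  proof
    show "\<exists>p. hvar p (\<phi> p) \<in> J" if "hmonom \<phi> \<in> J"
      using primeideal_prod[OF J _ that[unfolded hmonom_def]] by auto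
  next
    assume "\<exists>p. hvar p (\<phi> p) \<in> J"
    then obtain p where "hvar p (\<phi> p) \<in> J" ..
    moreover have "hmonom \<phi> = (\<Prod>r \<in> UNIV - {p}. hvar r (\<phi> r)) * (hvar p (\<phi> p) :: ('p, 'q, 'k) hpoly)"
      by (simp add: hmonom_def prod.remove[of UNIV p] mult.commute)
    ultimately show "hmonom \<phi> \<in> J"
      by (simp add: ideal_mult[OF is_ideal])
  qed
  then show ?thesis
    by (auto simp: hom_ideal_def hring_Idl(3)[OF is_ideal])
qed

lemma MHom_if_meets_all_Hom:
  fixes \<psi> :: "('q::{finite,order} \<times> 'p::{finite,order}) set"
  assumes meets: "\<And>\<phi> :: 'p \<Rightarrow> 'q. \<phi> \<in> Hom \<Longrightarrow> \<exists>p. (\<phi> p, p) \<in> \<psi>"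
  shows "\<psi> \<in> MHom"
proof -
  have "\<psi> `` {q} \<noteq> {}" for q
    using meets[of "\<lambda>_. q"] by (auto simp: Hom_def mono_def)
  moreover have "\<exists>p \<in> \<psi> `` {q}. \<exists>p' \<in> \<psi> `` {q'}. p \<le> p'" if "q < q'" for q q'
  proof -
    define \<phi> where "\<phi> r = (if \<exists>p \<in> \<psi> `` {q}. p \<le> r then q' else q)" for r
    have "\<phi> \<in> Hom"
      using \<open>q < q'\<close> by (auto simp: Hom_def mono_def \<phi>_def intro: order.trans)
    then obtain r where "(\<phi> r, r) \<in> \<psi>"
      using meets by blast
    \<comment> \<open>The value \<open>\<phi> r = q\<close> is impossible: then \<open>r\<close>
      would lie in \<open>\<psi>(q)\<close>, hence in its up-set, where \<open>\<phi>\<close> takes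
      the value \<open>q'\<close>. So \<open>r\<close> lies in \<open>\<psi>(q')\<close> and above
      some \<open>p\<close> in \<open>\<psi>(q)\<close>.\<close>
    then show ?thesis
      by (auto simp: \<phi>_def split: if_splits)
  qed
  ultimately show ?thesis
    by (simp add: MHom_def)
qed

theorem proposition3p5:
  shows "(\<forall>J \<in> min_primes hring (hom_ideal :: ('p::{finite,order}, 'q::{finite,order}, 'k::field) hpoly set).
            \<exists>\<psi> \<in> (MHom :: ('q \<times> 'p) set set). J = var_ideal \<psi>) \<and>
         (\<forall>\<psi> \<in> (MHom :: ('q \<times> 'p) set set).
            (hom_ideal :: ('p, 'q, 'k) hpoly set) \<subseteq> var_ideal \<psi> \<longleftrightarrow>
            (\<forall>\<phi> \<in> (Hom :: ('p \<Rightarrow> 'q) set). \<exists>p. p \<in> \<psi> `` {\<phi> p}))"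
proof (intro conjI ballI)
  show "(hom_ideal :: ('p, 'q, 'k) hpoly set) \<subseteq> var_ideal \<psi> \<longleftrightarrow>
      (\<forall>\<phi> \<in> (Hom :: ('p \<Rightarrow> 'q) set). \<exists>p. p \<in> \<psi> `` {\<phi> p})" for \<psi>
    by (simp add: hom_ideal_subset_primeideal_iff[OF primeideal_var_ideal] hvar_in_var_ideal_iff)
next
  fix J :: "('p, 'q, 'k) hpoly set"
  assume "J \<in> min_primes hring hom_ideal"
  then have J: "primeideal J hring" "hom_ideal \<subseteq> J"
    and minimal: "\<And>J'. primeideal J' hring \<Longrightarrow> hom_ideal \<subseteq> J' \<Longrightarrow> J' \<subseteq> J \<Longrightarrow> J' = J"
    by (auto simp: min_primes_def)
  define \<psi> where "\<psi> = {(q, p). hvar p q \<in> J}"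
  have meets: "\<exists>p. (\<phi> p, p) \<in> \<psi>" if "\<phi> \<in> Hom" for \<phi>
    using J that by (simp add: \<psi>_def hom_ideal_subset_primeideal_iff)
  \<comment> \<open>\<open>J\<close> and \<open>var_ideal \<psi>\<close> contain the same variables,
    so the containment passes from one prime to the other.\<close>
  have "hom_ideal \<subseteq> (var_ideal \<psi> :: ('p, 'q, 'k) hpoly set)"
    using meets
    by (simp add: hom_ideal_subset_primeideal_iff[OF primeideal_var_ideal] hvar_in_var_ideal_iff)
  moreover have "var_ideal \<psi> \<subseteq> J"
    using J(1) by (auto simp: var_ideal_def primeideal_def hring_Idl(3) \<psi>_def)
  ultimately have "J = var_ideal \<psi>"
    using minimal[OF primeideal_var_ideal] by blast
  then show "\<exists>\<psi> \<in> (MHom :: ('q \<times> 'p) set set). J = var_ideal \<psi>"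
    using MHom_if_meets_all_Hom[OF meets] by blast
qed

end
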